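(* If $E$ is a ceer that is essentially bounded and not computable, then $E<E^+$.
   Context: A ceer is an equivalence relation on $\mathbb N$ c.e. as a subset of $\mathbb N^2$; $R_1\leq R_2$ means there is a total computable $f$ with $xR_1y\Leftrightarrow f(x)R_2f(y)$; $R_1<R_2$ means $R_1\leq R_2$ and $R_2\not\leq R_1$. A ceer is $k$-bounded if each class has at most $k$ elements; $E$ is essentially bounded if $E\leq S$ for some $k$-bounded ceer $S$, some $k>0$. The saturation jump $E^+$ is the equivalence relation on the set $[\mathbb N]^{<\omega}$ of finite subsets of $\mathbb N$ (identified with $\mathbb N$ via a fixed computable bijection) given by $xE^+y\Leftrightarrow [x]_E=[y]_E$, where $[X]_E=\{y:\exists x\in X\,(xEy)\}$. *)

theory Defs
  imports Main "HOL-Library.Nat_Bijection"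
begin

text \<open>
  Programs for the partial recursive functions of Kleene. Programs carry no arity: run on
  argument lists of a fixed length \<open>k\<close>, a program computes a \<open>k\<close>-ary partial recursive function
  (\<open>Succ\<close> and \<open>Proj i\<close> diverge on lists that are too short), and every \<open>k\<close>-ary partial recursive
  function arises in this way.
\<close>

datatype recf =
    Zero
  | Succ
  | Proj nat
  | Comp recf "recf list"
  | PrimRec recf recf
  | Mu recf

text \<open>\<open>evaluates p xs y\<close>: program \<open>p\<close> halts on input \<open>xs\<close> with output \<open>y\<close>.\<close>

inductive evaluates :: "recf \<Rightarrow> nat list \<Rightarrow> nat \<Rightarrow> bool" where
  eval_Zero: "evaluates Zero xs 0"
| eval_Succ: "evaluates Succ (x # xs) (Suc x)"
| eval_Proj: "i < length xs \<Longrightarrow> evaluates (Proj i) xs (xs ! i)"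
| eval_Comp: "list_all2 (\<lambda>g y. evaluates g xs y) gs ys \<Longrightarrow> evaluates f ys z
    \<Longrightarrow> evaluates (Comp f gs) xs z"
| eval_PrimRec_0: "evaluates f xs y \<Longrightarrow> evaluates (PrimRec f g) (0 # xs) y"
| eval_PrimRec_Suc: "evaluates (PrimRec f g) (n # xs) r \<Longrightarrow> evaluates g (n # r # xs) y
    \<Longrightarrow> evaluates (PrimRec f g) (Suc n # xs) y"
| eval_Mu: "evaluates f (n # xs) 0 \<Longrightarrow> (\<And>m. m < n \<Longrightarrow> \<exists>k. evaluates f (m # xs) (Suc k))
    \<Longrightarrow> evaluates (Mu f) xs n"

lemma evaluates_deterministic:
  "evaluates p xs y \<Longrightarrow> evaluates p xs z \<Longrightarrow> y = z"
proof (induction arbitrary: z rule: evaluates.induct)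
  case (eval_Comp xs gs ys f w)
  from eval_Comp.prems obtain ys' where
    ys': "list_all2 (\<lambda>g y. evaluates g xs y) gs ys'" "evaluates f ys' z"
    by cases auto
  have "ys = ys'"
    using eval_Comp.IH(1) ys'(1)
    by (auto simp: list_all2_conv_all_nth intro!: nth_equalityI)
  with ys'(2) eval_Comp.IH(2) show ?case by blast
next
  case (eval_Mu f n xs)
  from eval_Mu.prems have z: "evaluates f (z # xs) 0"
    "\<And>m. m < z \<Longrightarrow> \<exists>k. evaluates f (m # xs) (Suc k)"
    by (cases; blast)+
  have "\<not> n < z"
    using eval_Mu.IH(1) z(2) by fastforce
  moreover have "\<not> z < n"
    using eval_Mu.IH(2) z(1) by fastforce
  ultimately show ?case by simp
next
  case (eval_PrimRec_Suc f g n xs r y)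
  from eval_PrimRec_Suc.prems obtain r' where
    "evaluates (PrimRec f g) (n # xs) r'" "evaluates g (n # r' # xs) z"
    by cases auto
  with eval_PrimRec_Suc.IH show ?case by blast
next
  case (eval_Zero xs)
  then show ?case by cases simp
next
  case (eval_Succ x xs)
  then show ?case by cases simp
next
  case (eval_Proj i xs)
  from eval_Proj.prems show ?case by cases simp
next
  case (eval_PrimRec_0 f xs y g)
  from eval_PrimRec_0.prems have "evaluates f xs z" by cases auto
  with eval_PrimRec_0.IH show ?case by blast
qed

definition computable_fun :: "(nat \<Rightarrow> nat) \<Rightarrow> bool" where
  "computable_fun f \<longleftrightarrow> (\<exists>p. \<forall>x. evaluates p [x] (f x))"

definition computable_rel :: "nat rel \<Rightarrow> bool" where
  "computable_rel R \<longleftrightarrow> (\<exists>p. \<forall>x y. evaluates p [x, y] (if (x, y) \<in> R then 1 else 0))"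

text \<open>
  Computably enumerable: empty or listed by a total computable function \<open>\<nat> \<rightarrow> \<nat>\<^sup>2\<close>,
  here given by its two coordinate functions.
\<close>

definition ce_rel :: "nat rel \<Rightarrow> bool" where
  "ce_rel R \<longleftrightarrow> R = {} \<or>
    (\<exists>f g. computable_fun f \<and> computable_fun g \<and> R = range (\<lambda>n. (f n, g n)))"

definition ceer :: "nat rel \<Rightarrow> bool" where
  "ceer E \<longleftrightarrow> equiv UNIV E \<and> ce_rel E"

definition reducible :: "nat rel \<Rightarrow> nat rel \<Rightarrow> bool" where
  "reducible R1 R2 \<longleftrightarrow>
    (\<exists>f. computable_fun f \<and> (\<forall>x y. (x, y) \<in> R1 \<longleftrightarrow> (f x, f y) \<in> R2))"

definition strictly_reducible :: "nat rel \<Rightarrow> nat rel \<Rightarrow> bool" where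
  "strictly_reducible R1 R2 \<longleftrightarrow> reducible R1 R2 \<and> \<not> reducible R2 R1"

definition bounded_ceer :: "nat \<Rightarrow> nat rel \<Rightarrow> bool" where
  "bounded_ceer k S \<longleftrightarrow> ceer S \<and> (\<forall>C \<in> UNIV // S. finite C \<and> card C \<le> k)"

definition essentially_bounded :: "nat rel \<Rightarrow> bool" where
  "essentially_bounded E \<longleftrightarrow> (\<exists>k > 0. \<exists>S. bounded_ceer k S \<and> reducible E S)"

text \<open>
  Finite sets of natural numbers are coded by their canonical indices: \<open>set_decode a\<close> is the set
  of positions of the digit 1 in the binary expansion of \<open>a\<close>. The saturation \<open>[X]\<^sub>E\<close> is the
  image \<open>E `` X\<close>.
\<close>

definition saturation_jump :: "nat rel \<Rightarrow> nat rel" where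
  "saturation_jump E = {(a, b). E `` set_decode a = E `` set_decode b}"

end

theory Submission
  imports Defs
begin

text \<open>
  Call \<open>g\<close> a \<open>k\<close>-labelling of \<open>E\<close> if it is computable, elements with equal labels are
  equivalent, and every class carries at most \<open>k\<close> labels. A reduction of \<open>E\<close> to a \<open>k\<close>-bounded
  ceer is a \<open>k\<close>-labelling, and a \<open>1\<close>-labelling decides \<open>E\<close>. Let \<open>f\<close> reduce the saturation jump to
  \<open>E\<close>. Then \<open>F = g \<circ> f\<close> labels finite sets so that sets with equal labels have equal saturation, and
  every class of the jump carries at most \<open>k\<close> labels. Given \<open>k \<ge> 2\<close> equivalent numbers, their
  singletons together with the doubleton of the two smallest are \<open>k + 1\<close> sets with the same saturation, so two of them
  share a label; this collision is decidable and reveals that one of the numbers is equivalent to a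
  smaller one. Sending each number to an equivalent one without revealed smaller equivalents,
  found by enumerating \<open>E\<close>, is therefore a \<open>(k - 1)\<close>-labelling. Descending to \<open>k = 1\<close> makes \<open>E\<close>
  computable.
\<close>

section \<open>Total recursive functions on lists of fixed length\<close>

text \<open>Programs carry no arity, so the length is fixed here and behaviour on lists of other
  lengths is left open.\<close>

definition total_recursive :: "nat \<Rightarrow> (nat list \<Rightarrow> nat) \<Rightarrow> bool" where
  "total_recursive n f \<longleftrightarrow> (\<exists>p. \<forall>xs. length xs = n \<longrightarrow> evaluates p xs (f xs))"

lemma total_recursive_cong:
  assumes "total_recursive n f" "\<And>xs. length xs = n \<Longrightarrow> f xs = g xs"
  shows "total_recursive n g"
  using assms unfolding total_recursive_def by metis

lemma total_recursive_nth: "i < n \<Longrightarrow> total_recursive n (\<lambda>xs. xs ! i)"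
  unfolding total_recursive_def by (metis eval_Proj)

lemma total_recursive_comp:
  assumes "total_recursive (length gs) f" "\<And>g. g \<in> set gs \<Longrightarrow> total_recursive n g"
  shows "total_recursive n (\<lambda>xs. f (map (\<lambda>g. g xs) gs))"
proof -
  obtain p where p: "\<And>ys. length ys = length gs \<Longrightarrow> evaluates p ys (f ys)"
    using assms(1) unfolding total_recursive_def by blast
  obtain q where q: "\<And>g xs. g \<in> set gs \<Longrightarrow> length xs = n \<Longrightarrow> evaluates (q g) xs (g xs)"
    using assms(2) unfolding total_recursive_def by metis
  have "evaluates (Comp p (map q gs)) xs (f (map (\<lambda>g. g xs) gs))" if "length xs = n" for xs
    using that by (intro eval_Comp[where ys = "map (\<lambda>g. g xs) gs"])
      (auto simp: list_all2_conv_all_nth q p)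
  then show ?thesis unfolding total_recursive_def by blast
qed

lemma total_recursive_comp1:
  assumes "total_recursive 1 (\<lambda>xs. f (xs ! 0))" "total_recursive n a"
  shows "total_recursive n (\<lambda>xs. f (a xs))"
  using total_recursive_comp[of "[a]" "\<lambda>xs. f (xs ! 0)" n] assms by simp

lemma total_recursive_comp2:
  assumes "total_recursive 2 (\<lambda>xs. f (xs ! 0) (xs ! 1))"
    and "total_recursive n a" "total_recursive n b"
  shows "total_recursive n (\<lambda>xs. f (a xs) (b xs))"
proof -
  have "total_recursive (length [a, b]) (\<lambda>xs. f (xs ! 0) (xs ! 1))"
    using assms(1) by (simp add: numeral_2_eq_2)
  from total_recursive_comp[OF this, of n] assms(2,3) show ?thesis by auto
qed

lemma total_recursive_Suc:
  assumes "total_recursive n a"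
  shows "total_recursive n (\<lambda>xs. Suc (a xs))"
proof -
  have "evaluates Succ xs (Suc (xs ! 0))" if "length xs = 1" for xs
    using that by (cases xs) (auto intro: eval_Succ)
  then have "total_recursive 1 (\<lambda>xs. Suc (xs ! 0))"
    unfolding total_recursive_def by blast
  from total_recursive_comp1[OF this assms] show ?thesis .
qed

lemma total_recursive_const: "total_recursive n (\<lambda>xs. c)"
proof (induction c)
  case 0
  show ?case unfolding total_recursive_def by (blast intro: eval_Zero)
qed (rule total_recursive_Suc)

lemma total_recursive_primrec:
  assumes "total_recursive n f" "total_recursive (Suc (Suc n)) g"
  shows "total_recursive (Suc n)
    (\<lambda>xs. rec_nat (f (tl xs)) (\<lambda>m r. g (m # r # tl xs)) (xs ! 0))"
proof -
  obtain p where p: "\<And>ys. length ys = n \<Longrightarrow> evaluates p ys (f ys)"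
    using assms(1) unfolding total_recursive_def by blast
  obtain q where q: "\<And>ys. length ys = Suc (Suc n) \<Longrightarrow> evaluates q ys (g ys)"
    using assms(2) unfolding total_recursive_def by blast
  have "evaluates (PrimRec p q) (x # xs) (rec_nat (f xs) (\<lambda>m r. g (m # r # xs)) x)"
    if "length xs = n" for x xs
  proof (induction x)
    case 0
    show ?case using that by (auto intro: eval_PrimRec_0 p)
  next
    case (Suc x)
    moreover have "evaluates q (x # r # xs) (g (x # r # xs))" for r
      using that by (intro q) simp
    ultimately show ?case by (auto intro: eval_PrimRec_Suc)
  qed
  then have "evaluates (PrimRec p q) xs (rec_nat (f (tl xs)) (\<lambda>m r. g (m # r # tl xs)) (xs ! 0))"
    if "length xs = Suc n" for xs
    using that by (cases xs) auto
  then show ?thesis unfolding total_recursive_def by blast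
qed

text \<open>\<open>Mu\<close> halts only if every earlier value is defined and positive: totality of
  \<open>f\<close> gives the former, minimality the latter.\<close>

lemma total_recursive_Least:
  assumes "total_recursive (Suc n) f" "\<And>xs. length xs = n \<Longrightarrow> \<exists>m. f (m # xs) = 0"
  shows "total_recursive n (\<lambda>xs. LEAST m. f (m # xs) = 0)"
proof -
  obtain p where p: "\<And>ys. length ys = Suc n \<Longrightarrow> evaluates p ys (f ys)"
    using assms(1) unfolding total_recursive_def by blast
  have "evaluates (Mu p) xs (LEAST m. f (m # xs) = 0)" if len: "length xs = n" for xs
  proof (rule eval_Mu)
    have "f ((LEAST m. f (m # xs) = 0) # xs) = 0"
      using assms(2)[OF len] by (rule LeastI_ex)
    then show "evaluates p ((LEAST m. f (m # xs) = 0) # xs) 0"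
      using p[of "(LEAST m. f (m # xs) = 0) # xs"] len by simp
  next
    fix m assume "m < (LEAST m. f (m # xs) = 0)"
    then have "f (m # xs) \<noteq> 0" by (rule not_less_Least)
    then show "\<exists>k. evaluates p (m # xs) (Suc k)"
      using p[of "m # xs"] len by (metis length_Cons not0_implies_Suc)
  qed
  then show ?thesis unfolding total_recursive_def by blast
qed

section \<open>Arithmetic and bounded search\<close>

lemma total_recursive_add:
  assumes "total_recursive n a" "total_recursive n b"
  shows "total_recursive n (\<lambda>xs. a xs + b xs)"
proof -
  have rec: "rec_nat y (\<lambda>m r. Suc r) x = x + y" for x y :: nat
    by (induction x) auto
  have "total_recursive (Suc (Suc 0)) (\<lambda>xs. xs ! 0 + xs ! 1)"
    by (rule total_recursive_cong[OF total_recursive_primrec[of "Suc 0" "\<lambda>xs. xs ! 0" "\<lambda>xs. Suc (xs ! 1)"]])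
      (auto intro!: total_recursive_nth total_recursive_Suc simp: rec nth_tl)
  then show ?thesis
    using total_recursive_comp2[of "(+)"] assms by (simp add: numeral_2_eq_2)
qed

lemma total_recursive_pred:
  assumes "total_recursive n a"
  shows "total_recursive n (\<lambda>xs. a xs - 1)"
proof -
  have rec: "rec_nat 0 (\<lambda>m r. m) x = x - 1" for x :: nat
    by (cases x) auto
  have "total_recursive 1 (\<lambda>xs. xs ! 0 - 1)"
    using total_recursive_primrec[of 0 "\<lambda>xs. 0" "\<lambda>xs. xs ! 0"]
    by (simp add: rec total_recursive_const total_recursive_nth)
  from total_recursive_comp1[OF this assms] show ?thesis .
qed

lemma total_recursive_diff:
  assumes "total_recursive n a" "total_recursive n b"
  shows "total_recursive n (\<lambda>xs. a xs - b xs)"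
proof -
  have rec: "rec_nat y (\<lambda>m r. r - 1) x = y - x" for x y :: nat
    by (induction x) auto
  \<comment> \<open>Iterating the predecessor makes the subtrahend the recursion argument, so the
    arguments first appear in reverse order.\<close>
  have "total_recursive (Suc (Suc 0)) (\<lambda>xs. xs ! 1 - xs ! 0)"
    by (rule total_recursive_cong[OF total_recursive_primrec[of "Suc 0" "\<lambda>xs. xs ! 0" "\<lambda>xs. xs ! 1 - 1"]])
      (auto intro!: total_recursive_nth total_recursive_pred[simplified] simp: rec[simplified] nth_tl)
  then show ?thesis
    using total_recursive_comp2[of "\<lambda>x y. y - x" n b a] assms by (simp add: numeral_2_eq_2)
qed

lemma total_recursive_power2:
  assumes "total_recursive n a"
  shows "total_recursive n (\<lambda>xs. 2 ^ a xs)"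
proof -
  have rec: "rec_nat 1 (\<lambda>m r. r + r) x = (2 ^ x :: nat)" for x :: nat
    by (induction x) auto
  have "total_recursive 1 (\<lambda>xs. 2 ^ (xs ! 0))"
    using total_recursive_primrec[of 0 "\<lambda>xs. 1" "\<lambda>xs. xs ! 1 + xs ! 1"]
    by (simp add: rec[simplified] total_recursive_const total_recursive_nth total_recursive_add)
  from total_recursive_comp1[OF this assms] show ?thesis .
qed

text \<open>Serves as bounded search: a sum of 0/1 indicators vanishes exactly when no index is a
  witness.\<close>

lemma total_recursive_sum:
  assumes "total_recursive 2 (\<lambda>xs. h (xs ! 0) (xs ! 1))"
    and "total_recursive n b" "total_recursive n a"
  shows "total_recursive n (\<lambda>xs. \<Sum>i<b xs. h i (a xs))"
proof -
  have rec: "rec_nat 0 (\<lambda>m r. r + h m y) x = (\<Sum>i<x. h i y)" for x y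
    by (induction x) auto
  have "total_recursive 3 (\<lambda>xs. xs ! 1 + h (xs ! 0) (xs ! 2))"
    by (intro total_recursive_add total_recursive_comp2[OF assms(1)] total_recursive_nth) simp_all
  then have "total_recursive (Suc (Suc 0)) (\<lambda>xs. \<Sum>i<xs ! 0. h i (xs ! 1))"
    by (intro total_recursive_cong[OF total_recursive_primrec[of "Suc 0" "\<lambda>xs. 0" "\<lambda>xs. xs ! 1 + h (xs ! 0) (xs ! 2)"]])
      (auto intro!: total_recursive_const simp: rec nth_tl numeral_3_eq_3)
  then show ?thesis
    using total_recursive_comp2[of "\<lambda>x y. \<Sum>i<x. h i y" n b a] assms(2,3)
    by (simp add: numeral_2_eq_2)
qed

lemma total_recursive_eq:
  assumes "total_recursive n a" "total_recursive n b"
  shows "total_recursive n (\<lambda>xs. of_bool (a xs = b xs))"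
proof -
  \<comment> \<open>With truncated subtraction the inner sum is the distance of \<open>x\<close> and
    \<open>y\<close>.\<close>
  have "of_bool (x = y) = 1 - ((x - y) + (y - x))" for x y :: nat
    by auto
  then show ?thesis
    by (auto intro!: total_recursive_add total_recursive_diff total_recursive_const assms)
qed

lemma computable_fun_iff: "computable_fun f \<longleftrightarrow> total_recursive 1 (\<lambda>xs. f (xs ! 0))"
proof -
  have "(\<forall>xs. length xs = 1 \<longrightarrow> evaluates p xs (f (xs ! 0))) \<longleftrightarrow> (\<forall>x. evaluates p [x] (f x))" for p
    by (auto simp: length_Suc_conv)
  then show ?thesis unfolding computable_fun_def total_recursive_def by simp
qed

lemma total_recursive_computable_fun:
  assumes "computable_fun f" "total_recursive n a"
  shows "total_recursive n (\<lambda>xs. f (a xs))"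
  using total_recursive_comp1 assms unfolding computable_fun_iff .

lemmas total_recursive_intros =
  total_recursive_nth total_recursive_const total_recursive_add total_recursive_diff
  total_recursive_power2 total_recursive_eq

section \<open>Labellings\<close>

text \<open>Equality of labels replaces the bounded ceer, so that each descent step only has to
  produce a function.\<close>

definition labelling :: "nat rel \<Rightarrow> nat \<Rightarrow> (nat \<Rightarrow> nat) \<Rightarrow> bool" where
  "labelling E k g \<longleftrightarrow> computable_fun g \<and> (\<forall>x y. g x = g y \<longrightarrow> (x, y) \<in> E)
    \<and> (\<forall>x. finite (g ` E `` {x}) \<and> card (g ` E `` {x}) \<le> k)"

text \<open>All labels in the class of \<open>x\<close> lie in the one \<open>S\<close>-class of
  \<open>g x\<close>; equal labels are \<open>S\<close>-related by reflexivity.\<close>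

lemma essentially_bounded_labelling:
  assumes "essentially_bounded E"
  obtains k g where "k > 0" "labelling E k g"
proof -
  obtain k S g where k: "k > 0" and S: "bounded_ceer k S" and g: "computable_fun g"
    and red: "\<And>x y. (x, y) \<in> E \<longleftrightarrow> (g x, g y) \<in> S"
    using assms unfolding essentially_bounded_def reducible_def by blast
  have refl: "(x, x) \<in> S" for x
    using S unfolding bounded_ceer_def ceer_def equiv_def refl_on_def by blast
  have fin: "finite (S `` {x}) \<and> card (S `` {x}) \<le> k" for x
    using S quotientI[of x UNIV S] unfolding bounded_ceer_def by blast
  have sub: "g ` E `` {x} \<subseteq> S `` {g x}" for x
    using red by blast
  have "finite (g ` E `` {x}) \<and> card (g ` E `` {x}) \<le> k" for x
    using sub[of x] fin[of "g x"] by (meson card_mono finite_subset le_trans)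
  then have "labelling E k g"
    unfolding labelling_def using g red refl by metis
  with k show thesis by (rule that)
qed

lemma labelling_1_computable:
  assumes "labelling E 1 g" "equiv UNIV E"
  shows "computable_rel E"
proof -
  have g: "computable_fun g" using assms(1) unfolding labelling_def by blast
  have iff: "(x, y) \<in> E \<longleftrightarrow> g x = g y" for x y
  proof
    assume xy: "(x, y) \<in> E"
    have "x \<in> E `` {x}" "y \<in> E `` {x}"
      using xy assms(2) by (auto simp: equiv_def refl_on_def)
    moreover have "finite (g ` E `` {x})" "card (g ` E `` {x}) \<le> Suc 0"
      using assms(1) unfolding labelling_def by auto
    ultimately show "g x = g y"
      by (metis card_le_Suc0_iff_eq imageI)
  qed (use assms(1) in \<open>simp add: labelling_def\<close>)
  have "total_recursive 2 (\<lambda>xs. of_bool (g (xs ! 0) = g (xs ! 1)))"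
    by (intro total_recursive_intros total_recursive_computable_fun[OF g]) simp_all
  then obtain p where p: "\<And>xs. length xs = 2 \<Longrightarrow> evaluates p xs (of_bool (g (xs ! 0) = g (xs ! 1)))"
    unfolding total_recursive_def by blast
  have "evaluates p [x, y] (if (x, y) \<in> E then 1 else 0)" for x y
    using p[of "[x, y]"] by (auto simp: iff)
  then show ?thesis unfolding computable_rel_def by blast
qed

section \<open>Codes of singletons and doubletons\<close>

lemma set_decode_power2: "set_decode (2 ^ x) = {x}"
  using set_encode_inverse[of "{x}"] by (simp add: set_encode_def)

text \<open>Distinctness excludes a carry: \<open>2 ^ x + 2 ^ x\<close> codes the singleton of
  \<open>Suc x\<close>.\<close>

lemma set_decode_add_power2: "x \<noteq> y \<Longrightarrow> set_decode (2 ^ x + 2 ^ y) = {x, y}"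
  using set_encode_inverse[of "{x, y}"] by (simp add: set_encode_def)

text \<open>A digit at a position \<open>x \<ge> y\<close> would force \<open>X \<ge> 2 ^ x\<close>.
  Hence a search through \<open>X < 2 ^ y\<close> meets only sets of numbers below
  \<open>y\<close>.\<close>

lemma set_decode_less: "X < 2 ^ y \<Longrightarrow> x \<in> set_decode X \<Longrightarrow> x < y"
proof (rule ccontr)
  assume X: "X < 2 ^ y" "x \<in> set_decode X" "\<not> x < y"
  then have "X < 2 ^ x"
    by (meson le_less_trans not_less one_le_numeral power_increasing_iff less_le_trans power_increasing)
  then show False using X(2) by (simp add: set_decode_def)
qed

text \<open>Puts the doubletons of numbers below \<open>y\<close> within the range of that
  search.\<close>

lemma add_power2_less: "x < y \<Longrightarrow> z < y \<Longrightarrow> x \<noteq> z \<Longrightarrow> 2 ^ x + 2 ^ z < (2 ^ y :: nat)"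
proof -
  have *: "2 ^ x + 2 ^ z < (2 ^ y :: nat)" if "x < z" "z < y" for x z
  proof -
    have "2 ^ x + 2 ^ z < 2 ^ z + (2 ^ z :: nat)" using that by simp
    also have "\<dots> = 2 ^ Suc z" by simp
    also have "\<dots> \<le> 2 ^ y" using that by (intro power_increasing) auto
    finally show ?thesis .
  qed
  show "x < y \<Longrightarrow> z < y \<Longrightarrow> x \<noteq> z \<Longrightarrow> ?thesis"
    using *[of x z] *[of z x] by (cases x z rule: linorder_cases) (auto simp: add.commute)
qed

lemma reducible_saturation_jump:
  assumes "equiv UNIV E"
  shows "reducible E (saturation_jump E)"
proof -
  have "computable_fun (\<lambda>x. 2 ^ x)"
    unfolding computable_fun_iff by (intro total_recursive_intros) simp
  moreover have "(x, y) \<in> E \<longleftrightarrow> (2 ^ x, 2 ^ y) \<in> saturation_jump E" for x y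
    using eq_equiv_class_iff[OF assms, of x y]
    by (simp add: saturation_jump_def set_decode_power2)
  ultimately show ?thesis unfolding reducible_def by blast
qed

section \<open>Reducing the number of labels\<close>

text \<open>All quantifiers are bounded, which makes this decidable. The second disjunct treats
  doubletons with maximum \<open>y\<close>; their codes exceed \<open>2 ^ y\<close> and escape the
  first.\<close>

definition collides :: "(nat \<Rightarrow> nat) \<Rightarrow> nat \<Rightarrow> bool" where
  "collides F y \<longleftrightarrow> (\<exists>X<2 ^ y. F X = F (2 ^ y))
    \<or> (\<exists>x<y. F (2 ^ x + 2 ^ y) = F (2 ^ x) \<or> F (2 ^ x + 2 ^ y) = F (2 ^ y))"

lemma total_recursive_collides:
  assumes "computable_fun F"
  obtains e where "computable_fun e" "\<And>y. e y = 0 \<longleftrightarrow> \<not> collides F y"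
proof
  \<comment> \<open>Counts the recorded collisions by bounded sums.\<close>
  define e :: "nat \<Rightarrow> nat" where "e y = (\<Sum>X<2 ^ y. of_bool (F X = F (2 ^ y)))
    + (\<Sum>x<y. of_bool (F (2 ^ x + 2 ^ y) = F (2 ^ x)) + of_bool (F (2 ^ x + 2 ^ y) = F (2 ^ y)))"
    for y
  show "computable_fun e"
    unfolding computable_fun_iff e_def
    by (intro total_recursive_intros total_recursive_sum total_recursive_computable_fun[OF assms])
      simp_all
  show "e y = 0 \<longleftrightarrow> \<not> collides F y" for y
    by (auto simp: e_def collides_def)
qed

text \<open>Equal labels force equal saturations. Depending on the collision, \<open>y\<close> lies
  in the saturation of a set of smaller numbers, or a smaller \<open>x\<close> lies in the class of
  \<open>y\<close>.\<close>

lemma collides_smaller_equivalent: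
  assumes E: "equiv UNIV E"
    and F: "\<And>X Y. F X = F Y \<Longrightarrow> (X, Y) \<in> saturation_jump E"
    and "collides F y"
  shows "\<exists>z<y. (y, z) \<in> E"
proof -
  have refl: "(x, x) \<in> E" for x using E by (auto simp: equiv_def refl_on_def)
  have sym: "(x, y) \<in> E \<Longrightarrow> (y, x) \<in> E" for x y using E by (auto simp: equiv_def sym_def)
  have *: "E `` set_decode X = E `` set_decode Y" if "F X = F Y" for X Y
    using F[OF that] by (simp add: saturation_jump_def)
  from assms(3) consider
      X where "X < 2 ^ y" "F X = F (2 ^ y)"
    | x where "x < y" "F (2 ^ x + 2 ^ y) = F (2 ^ x)"
    | x where "x < y" "F (2 ^ x + 2 ^ y) = F (2 ^ y)"
    unfolding collides_def by blast
  then show ?thesis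
  proof cases
    case 1
    with *[of X "2 ^ y"] have "y \<in> E `` set_decode X"
      by (simp add: set_decode_power2 refl)
    then show ?thesis using set_decode_less[OF 1(1)] sym by blast
  next
    case 2
    with *[of "2 ^ x + 2 ^ y" "2 ^ x"] have "E `` {x, y} = E `` {x}"
      by (simp add: set_decode_power2 set_decode_add_power2)
    then show ?thesis using 2(1) sym refl by blast
  next
    case 3
    with *[of "2 ^ x + 2 ^ y" "2 ^ y"] have "E `` {x, y} = E `` {y}"
      by (simp add: set_decode_power2 set_decode_add_power2)
    then show ?thesis using 3(1) refl by blast
  qed
qed

text \<open>Pigeonhole: the \<open>k\<close> singletons and one doubleton, available since
  \<open>k \<ge> 2\<close>, share a saturation but have at most \<open>k\<close> labels.\<close>

lemma collides_if_many_equivalent: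
  assumes E: "equiv UNIV E"
    and F: "\<And>X. finite (F ` saturation_jump E `` {X}) \<and> card (F ` saturation_jump E `` {X}) \<le> k"
    and T: "T \<subseteq> E `` {x}" "finite T" "card T = k" "k \<ge> 2"
  shows "\<exists>y\<in>T. collides F y"
proof -
  have cls: "E `` {t} = E `` {x}" if "t \<in> T" for t
    using that T(1) E by (metis Image_singleton_iff equiv_class_eq subsetD)
  \<comment> \<open>With the two smallest elements no \<open>t \<in> T\<close> satisfies \<open>a \<noteq> t < b\<close>; a collision of \<open>{a, b}\<close>
    with such a \<open>{t}\<close> is not recorded by \<open>collides\<close>.\<close>
  define a where "a = Min T"
  define b where "b = Min (T - {a})"
  have "T \<noteq> {}" using T(3,4) by auto
  then have a: "a \<in> T" "\<And>t. t \<in> T \<Longrightarrow> a \<le> t" using T(2) by (simp_all add: a_def)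
  have "card (T - {a}) = k - 1" using a T(2,3) by simp
  with T(4) have "card (T - {a}) \<noteq> 0" by linarith
  then have "T - {a} \<noteq> {}" by (metis card.empty)
  then have b: "b \<in> T - {a}" "\<And>t. t \<in> T - {a} \<Longrightarrow> b \<le> t"
    using T(2) unfolding b_def by (metis Min_in finite_Diff, metis Min_le finite_Diff)
  have ab: "a \<in> T" "b \<in> T" "a < b" using a b(1) by (auto simp: le_less)
  define D :: nat where "D = 2 ^ a + 2 ^ b"
  have D: "set_decode D = {a, b}" using ab(3) by (simp add: D_def set_decode_add_power2)
  define P :: "nat set" where "P = insert D ((\<lambda>t. 2 ^ t) ` T)"
  \<comment> \<open>A doubleton is no singleton, so \<open>D\<close> adds a new code to the
    \<open>k\<close> powers of two.\<close>
  have "D \<noteq> 2 ^ t" for t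
  proof
    assume "D = 2 ^ t"
    then have "{a, b} = {t}" using D set_decode_power2[of t] by simp
    then show False using ab(3) by auto
  qed
  then have "card P = Suc k"
    using T(2,3) by (simp add: P_def card_insert_if image_iff card_image inj_on_def)
  have pair: "E `` {a, b} = E `` {x}"
    using cls[OF ab(1)] cls[OF ab(2)] by blast
  have "P \<subseteq> saturation_jump E `` {2 ^ x}"
  proof
    fix X assume "X \<in> P"
    then consider "X = D" | t where "t \<in> T" "X = 2 ^ t"
      unfolding P_def by blast
    then have "E `` set_decode X = E `` {x}"
      by cases (simp_all add: pair D set_decode_power2 cls)
    then show "X \<in> saturation_jump E `` {2 ^ x}"
      by (simp add: saturation_jump_def set_decode_power2)
  qed
  then have "card (F ` P) \<le> k"
    using F[of "2 ^ x"] by (meson card_mono image_mono le_trans)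
  then have "\<not> inj_on F P"
    using \<open>card P = Suc k\<close> by (auto dest: card_image)
  then obtain X Y where XY: "X \<in> P" "Y \<in> P" "X \<noteq> Y" "F X = F Y"
    unfolding inj_on_def by blast
  have double: ?thesis if t: "t \<in> T" "F D = F (2 ^ t)" for t
  proof -
    \<comment> \<open>The choice of \<open>a\<close> and \<open>b\<close> leaves only these cases.
      The first two are collisions at \<open>b\<close> from the second disjunct of
      \<open>collides\<close>; in the third \<open>D\<close> is itself a code below
      \<open>2 ^ t\<close>.\<close>
    consider "t = a" | "t = b" | "b < t" using b(2)[of t] t by fastforce
    then show ?thesis
    proof cases
      case 1
      then have "collides F b" using that ab(3) unfolding collides_def D_def by auto
      then show ?thesis using ab by blast
    next
      case 2
      then have "collides F b" using that ab(3) unfolding collides_def D_def by auto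
      then show ?thesis using ab by blast
    next
      case 3
      then have "D < 2 ^ t" using ab(3) unfolding D_def by (intro add_power2_less) auto
      then have "collides F t" using that unfolding collides_def by blast
      then show ?thesis using that by blast
    qed
  qed
  have single: ?thesis if "s \<in> T" "t \<in> T" "s < t" "F (2 ^ s) = F (2 ^ t)" for s t
  proof -
    have "2 ^ s < (2 ^ t :: nat)" using that by simp
    then have "collides F t" using that unfolding collides_def by blast
    then show ?thesis using that by blast
  qed
  show ?thesis
  proof (cases "X = D \<or> Y = D")
    case True
    then obtain t where "t \<in> T" "F D = F (2 ^ t)"
      using XY unfolding P_def by auto
    then show ?thesis by (rule double)
  next
    case False
    then obtain s t where st: "s \<in> T" "t \<in> T" "X = 2 ^ s" "Y = 2 ^ t"
      using XY(1,2) unfolding P_def by blast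
    then show ?thesis
      using XY(3,4) single[of s t] single[of t s] by (cases s t rule: linorder_cases) simp_all
  qed
qed

text \<open>Numbers without a collision become the new labels: any \<open>Suc k\<close> equivalent
  numbers include one with a collision, so a class has at most \<open>k\<close> of them.\<close>

lemma labelling_Suc_reduce:
  assumes E: "ceer E" and lab: "labelling E (Suc k) g" and k: "k \<ge> 1"
    and f: "computable_fun f"
    and red: "\<And>X Y. (X, Y) \<in> saturation_jump E \<longleftrightarrow> (f X, f Y) \<in> E"
  shows "\<exists>g'. labelling E k g'"
proof -
  have eq: "equiv UNIV E" using E unfolding ceer_def by blast
  have refl: "(x, x) \<in> E" for x using eq by (auto simp: equiv_def refl_on_def)
  have sym: "(x, y) \<in> E \<Longrightarrow> (y, x) \<in> E" for x y using eq by (auto simp: equiv_def sym_def)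
  have trans: "(x, y) \<in> E \<Longrightarrow> (y, z) \<in> E \<Longrightarrow> (x, z) \<in> E" for x y z
    using eq unfolding equiv_def trans_def by blast
  \<comment> \<open>Reflexivity rules out the empty case of \<open>ce_rel\<close>.\<close>
  obtain u v where u: "computable_fun u" and v: "computable_fun v"
    and uv: "E = range (\<lambda>n. (u n, v n))"
    using E refl unfolding ceer_def ce_rel_def by blast
  define F where "F X = g (f X)" for X
  have g: "computable_fun g" using lab unfolding labelling_def by blast
  have "computable_fun F"
    unfolding computable_fun_iff F_def
    by (intro total_recursive_computable_fun[OF g] total_recursive_computable_fun[OF f]
        total_recursive_intros) simp
  have Feq: "(X, Y) \<in> saturation_jump E" if "F X = F Y" for X Y
    using that lab red unfolding F_def labelling_def by blast
  \<comment> \<open>\<open>f\<close> maps a class of the jump into one class of \<open>E\<close>, so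
    the label bound carries over to \<open>F\<close>.\<close>
  have "F ` saturation_jump E `` {X} \<subseteq> g ` E `` {f X}" for X
    using red by (auto simp: F_def)
  then have Fcard: "finite (F ` saturation_jump E `` {X})
      \<and> card (F ` saturation_jump E `` {X}) \<le> Suc k" for X
    using lab unfolding labelling_def by (meson card_mono finite_subset le_trans)
  obtain e where e: "computable_fun e" "\<And>y. e y = 0 \<longleftrightarrow> \<not> collides F y"
    using total_recursive_collides[OF \<open>computable_fun F\<close>] by blast
  \<comment> \<open>Replacing a colliding number by a smaller equivalent one must end.\<close>
  have below: "\<exists>z. (y, z) \<in> E \<and> \<not> collides F z" for y
  proof (induction y rule: less_induct)
    case (less y)
    show ?case
    proof (cases "collides F y")
      case True
      then obtain z where "z < y" "(y, z) \<in> E"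
        using collides_smaller_equivalent[OF eq Feq] by blast
      then show ?thesis using less trans by blast
    qed (use refl in blast)
  qed
  have ex: "\<exists>n. u n = y \<and> \<not> collides F (v n)" for y
    using below[of y] unfolding uv by blast
  \<comment> \<open>A zero test for the search through the enumeration: the differences vanish iff
    \<open>u n = y\<close>. The search variable comes first, as in
    \<open>total_recursive_Least\<close>.\<close>
  define step where "step n y = (u n - y) + (y - u n) + e (v n)" for n y
  have step: "step n y = 0 \<longleftrightarrow> u n = y \<and> \<not> collides F (v n)" for n y
    using e(2) by (auto simp: step_def)
  define g' where "g' y = v (LEAST n. step n y = 0)" for y
  have "total_recursive 2 (\<lambda>xs. step (xs ! 0) (xs ! 1))"
    unfolding step_def
    by (intro total_recursive_intros total_recursive_computable_fun[OF u]
        total_recursive_computable_fun[OF e(1)] total_recursive_computable_fun[OF v]) simp_all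
  then have "total_recursive 1 (\<lambda>xs. LEAST n. step n (xs ! 0) = 0)"
    using total_recursive_Least[of 1 "\<lambda>xs. step (xs ! 0) (xs ! 1)"] ex
    by (simp add: numeral_2_eq_2 step)
  then have comp: "computable_fun g'"
    unfolding computable_fun_iff g'_def by (rule total_recursive_computable_fun[OF v])
  have g': "(y, g' y) \<in> E" "\<not> collides F (g' y)" for y
  proof -
    have "step (LEAST n. step n y = 0) y = 0"
      using ex[of y] unfolding step by (rule LeastI_ex)
    then have *: "u (LEAST n. step n y = 0) = y" "\<not> collides F (g' y)"
      using step unfolding g'_def by blast+
    have "(u n, v n) \<in> E" for n unfolding uv by blast
    from this[of "LEAST n. step n y = 0"] show "(y, g' y) \<in> E"
      unfolding *(1) g'_def .
    show "\<not> collides F (g' y)" by (rule *(2))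
  qed
  have "finite (g' ` E `` {x}) \<and> card (g' ` E `` {x}) \<le> k" for x
  proof (rule ccontr)
    assume "\<not> ?thesis"
    then obtain T where T: "T \<subseteq> g' ` E `` {x}" "finite T" "card T = Suc k"
      by (metis infinite_arbitrarily_large not_less_eq_eq obtain_subset_with_card_n)
    \<comment> \<open>Each label is itself a member of the class it labels, so the pigeonhole lemma
      applies to a set of labels.\<close>
    have "T \<subseteq> E `` {x}" using T(1) g'(1) trans by blast
    then have "\<exists>y\<in>T. collides F y"
      using collides_if_many_equivalent[OF eq Fcard _ T(2,3)] k by simp
    then show False using T(1) g'(2) by blast
  qed
  moreover have "(x, y) \<in> E" if "g' x = g' y" for x y
    using g'(1)[of x] g'(1)[of y] that sym trans by metis
  ultimately have "labelling E k g'"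
    unfolding labelling_def using comp by blast
  then show ?thesis by blast
qed

theorem theorem7p4:
  fixes E :: "nat rel"
  assumes "ceer E"
    and "essentially_bounded E"
    and "\<not> computable_rel E"
  shows "strictly_reducible E (saturation_jump E)"
proof -
  have eq: "equiv UNIV E" using assms(1) unfolding ceer_def by blast
  have "\<not> reducible (saturation_jump E) E"
  proof
    assume "reducible (saturation_jump E) E"
    then obtain f where f: "computable_fun f"
      "\<And>X Y. (X, Y) \<in> saturation_jump E \<longleftrightarrow> (f X, f Y) \<in> E"
      unfolding reducible_def by blast
    obtain k g where k: "k > 0" "labelling E k g"
      using essentially_bounded_labelling[OF assms(2)] .
    \<comment> \<open>The same \<open>f\<close> serves at every level while the labelling changes,
      hence the generalisation over \<open>g\<close>.\<close>
    have "\<exists>g. labelling E 1 g"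
      using k
    proof (induction k arbitrary: g rule: nat_induct_non_zero)
      case (Suc k)
      have "\<exists>g'. labelling E k g'"
        using labelling_Suc_reduce[OF assms(1) Suc.prems _ f] Suc.hyps by simp
      then show ?case using Suc.IH by blast
    qed blast
    then show False using labelling_1_computable eq assms(3) by blast
  qed
  then show ?thesis
    unfolding strictly_reducible_def using reducible_saturation_jump[OF eq] by blast
qed

end
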